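(* Let $\tilde{A}=\widehat{A}+\epsilon_2\widehat{A}_{0}$ be an $n\times n$ hyper-dual matrix such that the dual index of $\widehat{A}$ is 1. If a hyper-dual group generalized inverse of $\tilde{A}$ exists, then it is unique.
   Context: Hyper-dual numbers are elements $a_0+\epsilon_1a_1+\epsilon_2a_2+\epsilon_1\epsilon_2a_3$ with $a_i\in\mathbb{R}$, where $\epsilon_1,\epsilon_2$ commute, $\epsilon_1^2=\epsilon_2^2=0$ and $\epsilon_1\epsilon_2\ne0$ (i.e. the commutative ring $\mathbb{R}[\epsilon_1,\epsilon_2]/(\epsilon_1^2,\epsilon_2^2)$). An $n\times n$ dual matrix is $\widehat{A}=A_0+\epsilon_1A_1$ with $A_0,A_1\in\mathbb{R}^{n\times n}$; an $n\times n$ hyper-dual matrix is $\tilde A=\widehat A+\epsilon_2\widehat A_0$ with $\widehat A$ and $\widehat A_0$ dual matrices. A hyper-dual group generalized inverse (HDGGI) of $\tilde A$ is a hyper-dual matrix $\tilde X$ with $\tilde{A}\tilde{X}\tilde{A}=\tilde{A}$, $\tilde{X}\tilde{A}\tilde{X}=\tilde{X}$, $\tilde{A}\tilde{X}=\tilde{X}\tilde{A}$. A dual matrix $\widehat A$ has dual index 1 if the range spaces of $\widehat A^2$ and $\widehat A$ (as maps on dual vectors) coincide. *)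

theory Defs
  imports "HOL-Analysis.Analysis"
begin

text \<open>
  The ring \<open>'a[\<epsilon>]/(\<epsilon>\<^sup>2)\<close>: \<open>Dual a b\<close> stands for \<open>a + \<epsilon> b\<close>. Iterating the construction,
  \<open>real dual\<close> has the unit \<open>\<epsilon>\<^sub>1\<close>, and \<open>real dual dual\<close>, which adjoins \<open>\<epsilon>\<^sub>2\<close> to it, is
  \<open>\<real>[\<epsilon>\<^sub>1, \<epsilon>\<^sub>2]/(\<epsilon>\<^sub>1\<^sup>2, \<epsilon>\<^sub>2\<^sup>2)\<close>.
\<close>

datatype 'a dual = Dual (std_part: 'a) (inf_part: 'a)

instantiation dual :: (comm_ring_1) comm_ring_1
begin

definition zero_dual :: "'a dual" where
  "0 = Dual 0 0"

definition one_dual :: "'a dual" where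
  "1 = Dual 1 0"

definition plus_dual :: "'a dual \<Rightarrow> 'a dual \<Rightarrow> 'a dual" where
  "x + y = Dual (std_part x + std_part y) (inf_part x + inf_part y)"

definition uminus_dual :: "'a dual \<Rightarrow> 'a dual" where
  "- x = Dual (- std_part x) (- inf_part x)"

definition minus_dual :: "'a dual \<Rightarrow> 'a dual \<Rightarrow> 'a dual" where
  "x - y = Dual (std_part x - std_part y) (inf_part x - inf_part y)"

definition times_dual :: "'a dual \<Rightarrow> 'a dual \<Rightarrow> 'a dual" where
  "x * y = Dual (std_part x * std_part y)
                (std_part x * inf_part y + inf_part x * std_part y)"

instance
  by standard
     (simp_all add: zero_dual_def one_dual_def plus_dual_def uminus_dual_def
        minus_dual_def times_dual_def algebra_simps)

end

type_synonym hyperdual = "real dual dual"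

definition dual_of :: "'a::comm_ring_1 \<Rightarrow> 'a dual" where
  "dual_of a = Dual a 0"

definition dual_eps :: "'a::comm_ring_1 dual" where
  "dual_eps = Dual 0 1"

definition hd_of_real :: "real \<Rightarrow> hyperdual" where
  "hd_of_real a = dual_of (dual_of a)"

definition eps1 :: hyperdual where
  "eps1 = dual_of dual_eps"

definition eps2 :: hyperdual where
  "eps2 = dual_eps"

lemmas dual_defs = zero_dual_def one_dual_def plus_dual_def uminus_dual_def
  minus_dual_def times_dual_def dual_of_def dual_eps_def

lemma eps1_squared: "eps1 * eps1 = 0"
  and eps2_squared: "eps2 * eps2 = 0"
  and eps1_eps2_nonzero: "eps1 * eps2 \<noteq> 0"
  by (simp_all add: eps1_def eps2_def dual_defs)

lemma hyperdual_expansion: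
  "\<exists>!(a0, a1, a2, a3).
     z = hd_of_real a0 + eps1 * hd_of_real a1 + eps2 * hd_of_real a2
           + eps1 * eps2 * hd_of_real a3"
proof -
  have "hd_of_real a0 + eps1 * hd_of_real a1 + eps2 * hd_of_real a2
          + eps1 * eps2 * hd_of_real a3 = Dual (Dual a0 a1) (Dual a2 a3)" for a0 a1 a2 a3
    by (simp add: hd_of_real_def eps1_def eps2_def dual_defs)
  moreover obtain a0 a1 a2 a3 where "z = Dual (Dual a0 a1) (Dual a2 a3)"
    by (metis dual.exhaust)
  ultimately show ?thesis
    by auto
qed

lemma dual_of_add: "dual_of (a + b) = dual_of a + dual_of b"
  and dual_of_mult: "dual_of (a * b) = dual_of a * dual_of b"
  and dual_of_1: "dual_of 1 = 1"
  and dual_of_inject: "dual_of a = dual_of b \<longleftrightarrow> a = b"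
  by (simp_all add: dual_defs)

definition hyperdual_matrix ::
  "real dual ^ 'n ^ 'n \<Rightarrow> real dual ^ 'n ^ 'n \<Rightarrow> hyperdual ^ 'n ^ 'n" where
  "hyperdual_matrix A A0 = (\<chi> i j. dual_of (A $ i $ j) + eps2 * dual_of (A0 $ i $ j))"

lemma hyperdual_matrix_exhaust: "\<exists>A A0. M = hyperdual_matrix A A0"
proof -
  have "M = hyperdual_matrix (\<chi> i j. std_part (M $ i $ j)) (\<chi> i j. inf_part (M $ i $ j))"
    by (simp add: hyperdual_matrix_def vec_eq_iff eps2_def dual_defs)
  then show ?thesis
    by blast
qed

definition dual_index_1 :: "real dual ^ 'n ^ 'n \<Rightarrow> bool" where
  "dual_index_1 A \<longleftrightarrow>
     range (\<lambda>v :: real dual ^ 'n. (A ** A) *v v) = range (\<lambda>v :: real dual ^ 'n. A *v v)"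

definition is_HDGGI :: "hyperdual ^ 'n ^ 'n \<Rightarrow> hyperdual ^ 'n ^ 'n \<Rightarrow> bool" where
  "is_HDGGI A X \<longleftrightarrow> A ** X ** A = A \<and> X ** A ** X = X \<and> A ** X = X ** A"

end

theory Submission
  imports Defs
begin

text \<open>
  Group inverses are unique in every semigroup: if \<open>X\<close> and \<open>Y\<close> are group inverses of \<open>A\<close>, the
  idempotents \<open>AX\<close> and \<open>YA\<close> both equal \<open>YAAX\<close>, whence \<open>X = XAX = XAY = YAY = Y\<close>.
\<close>

lemma HDGGI_unique:
  assumes X: "is_HDGGI A X" and Y: "is_HDGGI A Y"
  shows "X = Y"
proof -
  have XA: "A ** X ** A = A" "X ** A ** X = X" "A ** X = X ** A"
    and YA: "A ** Y ** A = A" "Y ** A ** Y = Y" "A ** Y = Y ** A"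
    using X Y unfolding is_HDGGI_def by blast+
  have "A ** X = A ** Y ** A ** X"
    by (simp only: YA(1))
  \<comment> \<open>Both commutation laws act at once: \<open>(A ** Y) ** (A ** X)\<close> becomes
    \<open>(Y ** A) ** (X ** A)\<close>, which exposes \<open>A ** X ** A\<close> for collapsing to
    \<open>A\<close>.\<close>
  also have "\<dots> = Y ** (A ** X ** A)"
    by (metis XA(3) YA(3) matrix_mul_assoc)
  also have "\<dots> = A ** Y"
    by (simp only: XA(1) YA(3))
  finally have AX_eq_AY: "A ** X = A ** Y" .
  have "X = X ** (A ** X)"
    by (simp only: XA(2) matrix_mul_assoc)
  \<comment> \<open>The equality of idempotents is used twice, with commutation in between:
    \<open>X ** (A ** X)\<close> = \<open>X ** (A ** Y)\<close> = \<open>(A ** X) ** Y\<close> =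
    \<open>(A ** Y) ** Y\<close>.\<close>
  also have "\<dots> = Y ** A ** Y"
    by (metis AX_eq_AY XA(3) YA(3) matrix_mul_assoc)
  finally show ?thesis
    by (simp only: YA(2))
qed

theorem theorem3p2:
  fixes A A0 :: "real dual ^ 'n ^ 'n"
  assumes "dual_index_1 A"
    and "\<exists>X. is_HDGGI (hyperdual_matrix A A0) X"
  shows "\<exists>!X. is_HDGGI (hyperdual_matrix A A0) X"
  using assms(2) HDGGI_unique by blast

end
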